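(* There is an algorithm $\mathcal{A}$ which, given a set $W=\{s_1,\dots,s_n\}$ of $n$ binary strings, each of length $m$, and a target string $s\in\{0,1\}^m$, decides in time $O(m^2n)$ whether $s$ is representable by $W$ using only the operations $\wedge$ and $\vee$. Moreover, running $\mathcal{A}$ on the input $(W\cup\overline{W},s)$, where $\overline W$ is the set of bitwise negations of the strings in $W$, decides whether $s$ is representable by $W$ when negation is allowed as well.
   Context: All strings lie in $\{0,1\}^m$ with $m\ge 1$, and $n\ge1$. For strings $x,y\in\{0,1\}^m$, $x\wedge y$ and $x\vee y$ denote bitwise AND and bitwise OR, and $\overline{x}$ denotes bitwise negation. A string $s$ is representable by $W$ if there is a formula whose operators are in $\{\wedge,\vee\}$ and whose operands are (at least one, possibly repeated) elements of $W$, which evaluates to $s$. "Representable when negation is allowed" means that the formula may additionally use the unary operator of bitwise negation. *)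

theory Defs
  imports Main
begin

section \<open>Bit strings and formulas\<close>

type_synonym bitstring = "bool list"

definition bitstrings :: "nat \<Rightarrow> bitstring set" where
  "bitstrings m = {x. length x = m}"

definition bit_and :: "bitstring \<Rightarrow> bitstring \<Rightarrow> bitstring" where
  "bit_and x y = map2 (\<and>) x y"

definition bit_or :: "bitstring \<Rightarrow> bitstring \<Rightarrow> bitstring" where
  "bit_or x y = map2 (\<or>) x y"

definition bit_neg :: "bitstring \<Rightarrow> bitstring" where
  "bit_neg x = map Not x"

datatype formula =
    Operand bitstring
  | And formula formula
  | Or formula formula
  | Neg formula

primrec operands :: "formula \<Rightarrow> bitstring set" where
  "operands (Operand x) = {x}"
| "operands (And f g) = operands f \<union> operands g"
| "operands (Or f g) = operands f \<union> operands g"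
| "operands (Neg f) = operands f"

primrec eval_formula :: "formula \<Rightarrow> bitstring" where
  "eval_formula (Operand x) = x"
| "eval_formula (And f g) = bit_and (eval_formula f) (eval_formula g)"
| "eval_formula (Or f g) = bit_or (eval_formula f) (eval_formula g)"
| "eval_formula (Neg f) = bit_neg (eval_formula f)"

primrec negation_free :: "formula \<Rightarrow> bool" where
  "negation_free (Operand x) \<longleftrightarrow> True"
| "negation_free (And f g) \<longleftrightarrow> negation_free f \<and> negation_free g"
| "negation_free (Or f g) \<longleftrightarrow> negation_free f \<and> negation_free g"
| "negation_free (Neg f) \<longleftrightarrow> False"

definition representable :: "bitstring set \<Rightarrow> bitstring \<Rightarrow> bool" where
  "representable W s \<longleftrightarrow>
     (\<exists>f. negation_free f \<and> operands f \<subseteq> W \<and> eval_formula f = s)"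

definition representable_with_negation :: "bitstring set \<Rightarrow> bitstring \<Rightarrow> bool" where
  "representable_with_negation W s \<longleftrightarrow>
     (\<exists>f. operands f \<subseteq> W \<and> eval_formula f = s)"


section \<open>Random access machines\<close>

text \<open>
  Algorithms are programs of a unit-cost random access machine in the style of Cook and Reckhow.
  The only arithmetic is addition and (truncated) subtraction of natural numbers; there is no
  multiplication, shift or bitwise operation on machine words. A program is a finite
  list of instructions; it halts by moving the program counter past the end of the list.
  Registers are the fixed scratch cells of the program; they are kept apart from the
  indirectly addressed memory, which holds the input.
\<close>

type_synonym reg = nat

datatype instr =
    Const reg nat
  | Add reg reg reg
  | Sub reg reg reg
  | Load reg reg
  | Store reg reg
  | Jump nat
  | Jump_Zero reg nat

type_synonym program = "instr list"

datatype config = Config (pc: nat) (regs: "reg \<Rightarrow> nat") (mem: "nat \<Rightarrow> nat")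

primrec exec_instr :: "instr \<Rightarrow> config \<Rightarrow> config" where
  "exec_instr (Const r k) c = Config (Suc (pc c)) ((regs c)(r := k)) (mem c)"
| "exec_instr (Add r a b) c =
     Config (Suc (pc c)) ((regs c)(r := regs c a + regs c b)) (mem c)"
| "exec_instr (Sub r a b) c =
     Config (Suc (pc c)) ((regs c)(r := regs c a - regs c b)) (mem c)"
| "exec_instr (Load r a) c =
     Config (Suc (pc c)) ((regs c)(r := mem c (regs c a))) (mem c)"
| "exec_instr (Store a r) c =
     Config (Suc (pc c)) (regs c) ((mem c)(regs c a := regs c r))"
| "exec_instr (Jump l) c = Config l (regs c) (mem c)"
| "exec_instr (Jump_Zero r l) c =
     Config (if regs c r = 0 then l else Suc (pc c)) (regs c) (mem c)"

definition halted :: "program \<Rightarrow> config \<Rightarrow> bool" where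
  "halted P c \<longleftrightarrow> length P \<le> pc c"

definition step :: "program \<Rightarrow> config \<Rightarrow> config" where
  "step P c = (if halted P c then c else exec_instr (P ! pc c) c)"

definition initial_config :: "nat list \<Rightarrow> config" where
  "initial_config inp =
     Config 0 (\<lambda>_. 0) (\<lambda>a. if a < length inp then inp ! a else 0)"

text \<open>The answer of a halted machine is the content of register 0: 1 for yes, 0 for no.\<close>

definition answers_after :: "program \<Rightarrow> nat list \<Rightarrow> nat \<Rightarrow> bool \<Rightarrow> bool" where
  "answers_after P inp t b \<longleftrightarrow>
     (let c = (step P ^^ t) (initial_config inp)
      in halted P c \<and> regs c 0 = of_bool b)"

text \<open>
  The input (W, s) is laid out in consecutive memory cells, one bit per cell: m, n, the bits of
  s, and then the bits of the n strings of W, in the order given by the list ws that enumerates W.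
\<close>

definition encode_input :: "bitstring list \<Rightarrow> bitstring \<Rightarrow> nat list" where
  "encode_input ws s =
     [length s, length ws] @ map of_bool s @ concat (map (map of_bool) ws)"

end

theory Submission imports Defs begin

text \<open>
  A string \<open>s\<close> is representable by \<open>W\<close> iff for all positions \<open>i\<close>, \<open>j\<close> some \<open>w \<in> W\<close> satisfies
  \<open>s\<^sub>i \<le> w\<^sub>i\<close> and \<open>w\<^sub>j \<le> s\<^sub>j\<close>. Necessity is an induction on the formula: one of the two
  operands of a connective inherits both inequalities. For sufficiency, if \<open>w\<^sub>i\<^sub>j\<close> are such witnesses then
  \<open>s\<close> is the disjunction over \<open>i\<close> of the conjunctions over \<open>j\<close> of the \<open>w\<^sub>i\<^sub>j\<close>. The criterion is tested
  by three nested loops. With negation, De Morgan's laws push all negations to the operands.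
\<close>

section \<open>The criterion for representability\<close>

definition separated :: "bitstring set \<Rightarrow> bitstring \<Rightarrow> bool" where
  "separated W s \<longleftrightarrow>
     (\<forall>i<length s. \<forall>j<length s. \<exists>w\<in>W. (s ! i \<longrightarrow> w ! i) \<and> (w ! j \<longrightarrow> s ! j))"

lemma length_bit_and [simp]: "length (bit_and x y) = min (length x) (length y)"
  by (simp add: bit_and_def)

lemma length_bit_or [simp]: "length (bit_or x y) = min (length x) (length y)"
  by (simp add: bit_or_def)

lemma nth_bit_and [simp]:
  "i < length x \<Longrightarrow> i < length y \<Longrightarrow> bit_and x y ! i \<longleftrightarrow> x ! i \<and> y ! i"
  by (simp add: bit_and_def)

lemma nth_bit_or [simp]:
  "i < length x \<Longrightarrow> i < length y \<Longrightarrow> bit_or x y ! i \<longleftrightarrow> x ! i \<or> y ! i"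
  by (simp add: bit_or_def)

section \<open>Necessity of the criterion\<close>

lemma length_eval_formula:
  assumes "W \<subseteq> bitstrings m" "negation_free f" "operands f \<subseteq> W"
  shows "length (eval_formula f) = m"
  using assms(2,3) assms(1) by (induction f) (auto simp: bitstrings_def)

text \<open>A conjunction that is true at \<open>i\<close> makes both operands true there, and one
  that is false at \<open>j\<close> has an operand that is false at \<open>j\<close>: the witness
  for that operand serves. For a disjunction, choose instead an operand that is true at
  \<open>i\<close>; both operands are false at \<open>j\<close> if the disjunction is.\<close>

lemma eval_formula_separated:
  assumes W: "W \<subseteq> bitstrings m" and "negation_free f" "operands f \<subseteq> W" "i < m" "j < m"
  shows "\<exists>w\<in>W. (eval_formula f ! i \<longrightarrow> w ! i) \<and> (w ! j \<longrightarrow> eval_formula f ! j)"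
  using assms(2,3)
proof (induction f)
  case (And f g)
  then have "length (eval_formula f) = m" "length (eval_formula g) = m"
    using length_eval_formula[OF W] by auto
  then have "eval_formula (And f g) ! l \<longleftrightarrow> eval_formula f ! l \<and> eval_formula g ! l" if "l < m" for l
    using that by simp
  note this[OF assms(4)] this[OF assms(5)]
  with And show ?case by auto
next
  case (Or f g)
  then have "length (eval_formula f) = m" "length (eval_formula g) = m"
    using length_eval_formula[OF W] by auto
  then have "eval_formula (Or f g) ! l \<longleftrightarrow> eval_formula f ! l \<or> eval_formula g ! l" if "l < m" for l
    using that by simp
  note this[OF assms(4)] this[OF assms(5)]
  with Or show ?case by auto
qed auto

section \<open>Sufficiency of the criterion\<close>

lemma representable_operand: "x \<in> W \<Longrightarrow> representable W x"
  unfolding representable_def by (rule exI[of _ "Operand x"]) simp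

lemma representable_bit_and:
  assumes "representable W x" "representable W y"
  shows "representable W (bit_and x y)"
proof -
  obtain f g where "negation_free f" "operands f \<subseteq> W" "eval_formula f = x"
    "negation_free g" "operands g \<subseteq> W" "eval_formula g = y"
    using assms unfolding representable_def by blast
  then show ?thesis
    unfolding representable_def by (intro exI[of _ "And f g"]) simp
qed

lemma representable_bit_or:
  assumes "representable W x" "representable W y"
  shows "representable W (bit_or x y)"
proof -
  obtain f g where "negation_free f" "operands f \<subseteq> W" "eval_formula f = x"
    "negation_free g" "operands g \<subseteq> W" "eval_formula g = y"
    using assms unfolding representable_def by blast
  then show ?thesis
    unfolding representable_def by (intro exI[of _ "Or f g"]) simp
qed

text \<open>Formulas have no constants, so an empty conjunction need not be representable; the range
  \<open>j < Suc k\<close> keeps it nonempty, and the induction starts from the single string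
  \<open>v 0\<close>.\<close>

lemma representable_conjunction:
  assumes "\<And>j. j < Suc k \<Longrightarrow> representable W (v j)" "\<And>j. j < Suc k \<Longrightarrow> length (v j) = m"
  shows "\<exists>t. representable W t \<and> length t = m \<and> (\<forall>i<m. t ! i \<longleftrightarrow> (\<forall>j<Suc k. v j ! i))"
  using assms
proof (induction k)
  case (Suc k)
  then obtain t where t: "representable W t" "length t = m"
    "\<forall>i<m. t ! i \<longleftrightarrow> (\<forall>j<Suc k. v j ! i)"
    by (metis less_SucI)
  moreover have "representable W (v (Suc k))" "length (v (Suc k)) = m"
    using Suc.prems by auto
  ultimately show ?case
    by (intro exI[of _ "bit_and t (v (Suc k))"])
      (auto simp: representable_bit_and less_Suc_eq)
qed auto

lemma representable_disjunction:
  assumes "\<And>j. j < Suc k \<Longrightarrow> representable W (v j)" "\<And>j. j < Suc k \<Longrightarrow> length (v j) = m"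
  shows "\<exists>t. representable W t \<and> length t = m \<and> (\<forall>i<m. t ! i \<longleftrightarrow> (\<exists>j<Suc k. v j ! i))"
  using assms
proof (induction k)
  case (Suc k)
  then obtain t where t: "representable W t" "length t = m"
    "\<forall>i<m. t ! i \<longleftrightarrow> (\<exists>j<Suc k. v j ! i)"
    by (metis less_SucI)
  moreover have "representable W (v (Suc k))" "length (v (Suc k)) = m"
    using Suc.prems by auto
  ultimately show ?case
    by (intro exI[of _ "bit_or t (v (Suc k))"])
      (auto simp: representable_bit_or less_Suc_eq)
qed auto

lemma separated_imp_representable:
  assumes W: "W \<subseteq> bitstrings m" and s: "length s = Suc k" "m = Suc k" and "separated W s"
  shows "representable W s"
proof -
  have "\<forall>i\<in>{..<m}. \<forall>j\<in>{..<m}. \<exists>w. w \<in> W \<and> (s ! i \<longrightarrow> w ! i) \<and> (w ! j \<longrightarrow> s ! j)"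
    using assms(4) s unfolding separated_def by (simp add: Bex_def)
  then obtain w where w: "\<And>i j. i < m \<Longrightarrow> j < m \<Longrightarrow>
      w i j \<in> W \<and> (s ! i \<longrightarrow> w i j ! i) \<and> (w i j ! j \<longrightarrow> s ! j)"
    unfolding bchoice_iff by blast
  have "\<forall>i\<in>{..<m}. \<exists>t. representable W t \<and> length t = m \<and> (\<forall>l<m. t ! l \<longleftrightarrow> (\<forall>j<m. w i j ! l))"
  proof
    fix i
    assume i: "i \<in> {..<m}"
    have "representable W (w i j)" "length (w i j) = m" if "j < m" for j
      using w[of i j] i that W representable_operand by (auto simp: bitstrings_def)
    then show "\<exists>t. representable W t \<and> length t = m \<and> (\<forall>l<m. t ! l \<longleftrightarrow> (\<forall>j<m. w i j ! l))"
      unfolding s(2) by (rule representable_conjunction)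
  qed
  then obtain t where "\<forall>i\<in>{..<m}. representable W (t i) \<and> length (t i) = m \<and>
      (\<forall>l<m. t i ! l \<longleftrightarrow> (\<forall>j<m. w i j ! l))"
    unfolding bchoice_iff by blast
  then have t: "representable W (t i)" "length (t i) = m"
    "\<And>l. l < m \<Longrightarrow> t i ! l \<longleftrightarrow> (\<forall>j<m. w i j ! l)" if "i < m" for i
    using that by auto
  obtain u where u: "representable W u" "length u = m" "\<And>l. l < m \<Longrightarrow> u ! l \<longleftrightarrow> (\<exists>i<m. t i ! l)"
    using representable_disjunction[of k W t m] t(1,2) unfolding s(2) by auto
  \<comment> \<open>If a term \<open>t i\<close> is true at \<open>l\<close>, so is its conjunct
    \<open>w i l\<close>, which lies below \<open>s\<close> at \<open>l\<close>. Conversely, if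
    \<open>s\<close> is true at \<open>l\<close>, then so are all \<open>w l j\<close>, hence also
    the term \<open>t l\<close>.\<close>
  have "u ! l = s ! l" if l: "l < m" for l
  proof
    assume "u ! l"
    then obtain i where "i < m" "t i ! l"
      using u(3) l by blast
    then show "s ! l"
      using t(3) w l by blast
  next
    assume "s ! l"
    then have "t l ! l"
      using t(3) w l by blast
    then show "u ! l"
      using u(3) l by blast
  qed
  then have "u = s" using u(2) s by (simp add: list_eq_iff_nth_eq)
  then show ?thesis using u by simp
qed

lemma representable_iff_separated:
  assumes "W \<subseteq> bitstrings m" "length s = m" "m \<ge> 1"
  shows "representable W s \<longleftrightarrow> separated W s"
proof
  assume "representable W s"
  then show "separated W s"
    using eval_formula_separated[OF assms(1)] assms(2)
    unfolding representable_def separated_def by blast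
next
  assume "separated W s"
  then show "representable W s"
    using separated_imp_representable[OF assms(1), of s "m - 1"] assms(2,3) by simp
qed


section \<open>Elimination of negations\<close>

lemma bit_neg_bit_neg [simp]: "bit_neg (bit_neg x) = x"
  by (simp add: bit_neg_def o_def)

lemma bit_neg_bit_and: "bit_neg (bit_and x y) = bit_or (bit_neg x) (bit_neg y)"
  by (simp add: bit_neg_def bit_and_def bit_or_def zip_map_map o_def case_prod_unfold)

lemma bit_neg_bit_or: "bit_neg (bit_or x y) = bit_and (bit_neg x) (bit_neg y)"
  by (simp add: bit_neg_def bit_and_def bit_or_def zip_map_map o_def case_prod_unfold)

text \<open>The value and its complement are treated together: \<open>Neg\<close> merely exchanges
  the two claims, and De Morgan's laws handle the complement of a connective.\<close>

lemma representable_eval_formula: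
  assumes "operands f \<subseteq> W"
  shows "representable (W \<union> bit_neg ` W) (eval_formula f) \<and>
         representable (W \<union> bit_neg ` W) (bit_neg (eval_formula f))"
  using assms
  by (induction f)
    (auto simp: bit_neg_bit_and bit_neg_bit_or
       intro: representable_operand representable_bit_and representable_bit_or)

text \<open>Substitution at the leaves: an operand \<open>bit_neg y\<close> outside \<open>W\<close>
  can be written as \<open>Neg (Operand y)\<close>.\<close>

lemma eval_formula_with_negated_operands:
  assumes "operands f \<subseteq> W \<union> bit_neg ` W"
  shows "\<exists>g. operands g \<subseteq> W \<and> eval_formula g = eval_formula f"
  using assms
proof (induction f)
  case (Operand x)
  then consider "x \<in> W" | y where "y \<in> W" "x = bit_neg y" by auto
  then show ?case
  proof cases
    case 1
    then show ?thesis by (intro exI[of _ "Operand x"]) simp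
  next
    case 2
    then show ?thesis by (intro exI[of _ "Neg (Operand y)"]) simp
  qed
next
  case (And f g)
  then obtain f' g' where "operands f' \<subseteq> W" "eval_formula f' = eval_formula f"
    "operands g' \<subseteq> W" "eval_formula g' = eval_formula g"
    by auto
  then show ?case by (intro exI[of _ "And f' g'"]) simp
next
  case (Or f g)
  then obtain f' g' where "operands f' \<subseteq> W" "eval_formula f' = eval_formula f"
    "operands g' \<subseteq> W" "eval_formula g' = eval_formula g"
    by auto
  then show ?case by (intro exI[of _ "Or f' g'"]) simp
next
  case (Neg f)
  then obtain f' where "operands f' \<subseteq> W" "eval_formula f' = eval_formula f"
    by auto
  then show ?case by (intro exI[of _ "Neg f'"]) simp
qed

lemma representable_with_negation_iff:
  "representable_with_negation W s \<longleftrightarrow> representable (W \<union> bit_neg ` W) s"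
proof
  assume "representable_with_negation W s"
  then show "representable (W \<union> bit_neg ` W) s"
    unfolding representable_with_negation_def using representable_eval_formula by blast
next
  assume "representable (W \<union> bit_neg ` W) s"
  then show "representable_with_negation W s"
    unfolding representable_def representable_with_negation_def
    using eval_formula_with_negated_operands by metis
qed


section \<open>The program\<close>

text \<open>
  Registers 4, 5, 6 are the loop counters for \<open>i\<close>, \<open>j\<close> and the strings of \<open>W\<close>. They count down and
  the first two are 1-based, so that bit \<open>i\<close> of \<open>s\<close> sits in cell \<open>i + 1\<close> and bit \<open>i\<close> of the current
  string in cell \<open>b + i\<close>, where register 7 holds \<open>b\<close>, starting at \<open>m + 1\<close>. On bits, the truncated
  sum \<open>(s\<^sub>i - w\<^sub>i) + (w\<^sub>j - s\<^sub>j)\<close> vanishes iff \<open>s\<^sub>i \<le> w\<^sub>i\<close> and \<open>w\<^sub>j \<le> s\<^sub>j\<close>.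
\<close>

definition decide :: program where
  "decide =
    [Const 1 1, Load 2 0, Load 3 1, Add 4 2 0,
     \<comment> \<open>4: loop over \<open>i\<close>\<close>
     Jump_Zero 4 29, Add 8 4 1, Load 8 8, Add 5 2 0,
     \<comment> \<open>8: loop over \<open>j\<close>\<close>
     Jump_Zero 5 27, Add 9 5 1, Load 9 9, Add 6 3 0, Add 7 2 1,
     \<comment> \<open>13: loop over the strings\<close>
     Jump_Zero 6 30, Add 10 7 4, Load 10 10, Sub 10 8 10,
     Add 11 7 5, Load 11 11, Sub 11 11 9, Add 10 10 11, Jump_Zero 10 25,
     Sub 6 6 1, Add 7 7 2, Jump 13,
     \<comment> \<open>25: next \<open>j\<close>\<close>
     Sub 5 5 1, Jump 8,
     \<comment> \<open>27: next \<open>i\<close>\<close>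
     Sub 4 4 1, Jump 4,
     \<comment> \<open>29: accept\<close>
     Const 0 1]"

section \<open>Symbolic execution and time-bounded reachability\<close>

lemma length_decide: "length decide = 30"
  by (simp add: decide_def)

text \<open>One rewrite rule per instruction lets the simplifier execute straight-line blocks. The
  second rule says \<open>Suc 0\<close> because simplification turns the program counter 1 into that
  form.\<close>

lemma step_decide [simp]:
  "step decide (Config 0 R M) = Config 1 (R(1 := 1)) M"
  "step decide (Config (Suc 0) R M) = Config 2 (R(2 := M (R 0))) M"
  "step decide (Config 2 R M) = Config 3 (R(3 := M (R 1))) M"
  "step decide (Config 3 R M) = Config 4 (R(4 := R 2 + R 0)) M"
  "step decide (Config 4 R M) = Config (if R 4 = 0 then 29 else 5) R M"
  "step decide (Config 5 R M) = Config 6 (R(8 := R 4 + R 1)) M"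
  "step decide (Config 6 R M) = Config 7 (R(8 := M (R 8))) M"
  "step decide (Config 7 R M) = Config 8 (R(5 := R 2 + R 0)) M"
  "step decide (Config 8 R M) = Config (if R 5 = 0 then 27 else 9) R M"
  "step decide (Config 9 R M) = Config 10 (R(9 := R 5 + R 1)) M"
  "step decide (Config 10 R M) = Config 11 (R(9 := M (R 9))) M"
  "step decide (Config 11 R M) = Config 12 (R(6 := R 3 + R 0)) M"
  "step decide (Config 12 R M) = Config 13 (R(7 := R 2 + R 1)) M"
  "step decide (Config 13 R M) = Config (if R 6 = 0 then 30 else 14) R M"
  "step decide (Config 14 R M) = Config 15 (R(10 := R 7 + R 4)) M"
  "step decide (Config 15 R M) = Config 16 (R(10 := M (R 10))) M"
  "step decide (Config 16 R M) = Config 17 (R(10 := R 8 - R 10)) M"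
  "step decide (Config 17 R M) = Config 18 (R(11 := R 7 + R 5)) M"
  "step decide (Config 18 R M) = Config 19 (R(11 := M (R 11))) M"
  "step decide (Config 19 R M) = Config 20 (R(11 := R 11 - R 9)) M"
  "step decide (Config 20 R M) = Config 21 (R(10 := R 10 + R 11)) M"
  "step decide (Config 21 R M) = Config (if R 10 = 0 then 25 else 22) R M"
  "step decide (Config 22 R M) = Config 23 (R(6 := R 6 - R 1)) M"
  "step decide (Config 23 R M) = Config 24 (R(7 := R 7 + R 2)) M"
  "step decide (Config 24 R M) = Config 13 R M"
  "step decide (Config 25 R M) = Config 26 (R(5 := R 5 - R 1)) M"
  "step decide (Config 26 R M) = Config 8 R M"
  "step decide (Config 27 R M) = Config 28 (R(4 := R 4 - R 1)) M"
  "step decide (Config 28 R M) = Config 4 R M"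
  "step decide (Config 29 R M) = Config 30 (R(0 := 1)) M"
  by (simp_all add: step_def halted_def decide_def)

text \<open>Peels off the first step of a run rather than the last, so that
  \<open>step_decide\<close> applies to a configuration with known program counter.\<close>

lemma funpow_numeral: "(f ^^ numeral k) x = (f ^^ pred_numeral k) (f x)"
  by (simp add: numeral_eq_Suc funpow_swap1)

text \<open>An upper bound instead of an exact step count, since early exits from the loops make the
  count depend on the data.\<close>

definition reaches :: "nat \<Rightarrow> config \<Rightarrow> config \<Rightarrow> bool" where
  "reaches T c c' \<longleftrightarrow> (\<exists>t\<le>T. (step decide ^^ t) c = c')"

lemma reaches_refl: "reaches T c c"
  unfolding reaches_def by (rule exI[of _ 0]) simp

lemma reaches_funpow:
  assumes "(step decide ^^ k) c = c'" "reaches T c' c''" "k + T \<le> T'"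
  shows "reaches T' c c''"
proof -
  obtain t where "t \<le> T" "(step decide ^^ t) c' = c''"
    using assms(2) unfolding reaches_def by blast
  then have "(step decide ^^ (t + k)) c = c''" "t + k \<le> T'"
    using assms(1,3) by (auto simp: funpow_add)
  then show ?thesis unfolding reaches_def by blast
qed

lemma reaches_mono: "reaches T c c' \<Longrightarrow> T \<le> T' \<Longrightarrow> reaches T' c c'"
  by (rule reaches_funpow[where k = 0]) simp_all

lemma reaches_trans: "reaches T c c' \<Longrightarrow> reaches T' c' c'' \<Longrightarrow> reaches (T + T') c c''"
  unfolding reaches_def[of T c] using reaches_funpow[of _ c c' T'] by auto

section \<open>Correctness and running time of the nested loops\<close>

definition test :: "(nat \<Rightarrow> nat) \<Rightarrow> nat \<Rightarrow> nat \<Rightarrow> nat \<Rightarrow> bool" where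
  "test M i j b \<longleftrightarrow> M (i + 1) - M (b + i) + (M (b + j) - M (j + 1)) = 0"

text \<open>Induction on the number \<open>c\<close> of strings left, with the base address
  \<open>b\<close> of the next one generalized. A string that fails the test costs 9 + 3 = 12 steps;
  the summand 10 generously covers the exit. Registers 0 to 5 and 8 are preserved for the outer
  loops.\<close>

lemma string_loop:
  assumes "R 1 = 1" "R 2 = m" "R 4 = i" "R 5 = j" "R 6 = c" "R 7 = b"
    "R 8 = M (i + 1)" "R 9 = M (j + 1)"
  shows "\<exists>R'. (\<forall>r\<in>{..5} \<union> {8}. R' r = R r) \<and>
    reaches (12 * c + 10) (Config 13 R M)
      (Config (if \<exists>k<c. test M i j (b + k * m) then 25 else 30) R' M)"
  using assms
proof (induction c arbitrary: R b)
  case 0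
  have "reaches 1 (Config 13 R M) (Config 30 R M)"
    by (rule reaches_funpow[where k = 1, OF _ reaches_refl[of 0]]) (simp_all add: 0)
  then have "reaches (12 * 0 + 10) (Config 13 R M) (Config 30 R M)"
    by (rule reaches_funpow[where k = 0, rotated]) simp_all
  then show ?case by (intro exI[of _ R]) simp
next
  case (Suc c)
  define R1 where "R1 = R(10 := M (i + 1) - M (b + i) + (M (b + j) - M (j + 1)),
    11 := M (b + j) - M (j + 1))"
  have body: "(step decide ^^ 9) (Config 13 R M) = Config (if test M i j b then 25 else 22) R1 M"
    using Suc.prems by (simp add: funpow_numeral test_def R1_def fun_upd_twist)
  show ?case
  proof (cases "test M i j b")
    case True
    then have accept: "\<exists>k<Suc c. test M i j (b + k * m)" by (intro exI[of _ 0]) simp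
    have "reaches (12 * Suc c + 10) (Config 13 R M) (Config 25 R1 M)"
      by (rule reaches_funpow[OF body, of 0]) (simp_all add: True reaches_refl)
    moreover have "\<forall>r\<in>{..5} \<union> {8}. R1 r = R r"
      by (auto simp: R1_def)
    ultimately show ?thesis
      unfolding if_P[OF accept] by blast
  next
    case False
    define R2 where "R2 = R1(6 := c, 7 := b + m)"
    have R2: "R2 1 = 1" "R2 2 = m" "R2 4 = i" "R2 5 = j" "R2 6 = c" "R2 7 = b + m"
      "R2 8 = M (i + 1)" "R2 9 = M (j + 1)"
      using Suc.prems by (simp_all add: R2_def R1_def)
    have next_string: "(step decide ^^ 3) (Config 22 R1 M) = Config 13 R2 M"
      using Suc.prems by (simp add: funpow_numeral R1_def R2_def)
    obtain R' where R': "\<forall>r\<in>{..5} \<union> {8}. R' r = R2 r"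
      "reaches (12 * c + 10) (Config 13 R2 M)
        (Config (if \<exists>k<c. test M i j (b + m + k * m) then 25 else 30) R' M)"
      using Suc.IH[of R2 "b + m", OF R2] by blast
    \<comment> \<open>String 0 has failed, so the indices shift by one and the base address advances
      by \<open>m\<close>.\<close>
    have "(\<exists>k<Suc c. test M i j (b + k * m)) \<longleftrightarrow> (\<exists>k<c. test M i j (b + m + k * m))"
      using False by (simp add: Ex_less_Suc2 add.assoc)
    moreover have "reaches (12 * Suc c + 10) (Config 13 R M)
        (Config (if \<exists>k<c. test M i j (b + m + k * m) then 25 else 30) R' M)"
      by (rule reaches_funpow[OF body[unfolded if_not_P[OF False]]
            reaches_funpow[OF next_string R'(2) order_refl]]) simp
    ultimately show ?thesis
      using R'(1) by (intro exI[of _ R']) (simp add: R2_def R1_def)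
  qed
qed

text \<open>One column costs at most 5 steps to enter, \<open>12 * n + 10\<close> for the strings
  and 2 to move on, which gives \<open>12 * n + 17\<close>; the final 1 is the exit test. The
  counter runs downwards, so after column \<open>J\<close> exactly the columns \<open>j < J\<close>
  remain.\<close>

lemma column_loop:
  assumes "R 1 = 1" "R 2 = m" "R 3 = n" "R 0 = 0" "R 4 = i" "R 5 = J" "R 8 = M (i + 1)"
  shows "\<exists>R'. (\<forall>r\<le>4. R' r = R r) \<and>
    reaches ((12 * n + 17) * J + 1) (Config 8 R M)
      (Config (if \<forall>j<J. \<exists>k<n. test M i (j + 1) (m + 1 + k * m) then 27 else 30) R' M)"
  using assms
proof (induction J arbitrary: R)
  case 0
  have "reaches ((12 * n + 17) * 0 + 1) (Config 8 R M) (Config 27 R M)"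
    by (rule reaches_funpow[where k = 1, OF _ reaches_refl[of 0]]) (simp_all add: 0)
  then show ?case by (intro exI[of _ R]) simp
next
  case (Suc J)
  define found where "found \<longleftrightarrow> (\<exists>k<n. test M i (J + 1) (m + 1 + k * m))"
  define R1 where "R1 = R(9 := M (J + 2), 6 := n, 7 := m + 1)"
  have enter: "(step decide ^^ 5) (Config 8 R M) = Config 13 R1 M"
    using Suc.prems by (simp add: funpow_numeral R1_def)
  obtain R2 where R2: "\<forall>r\<in>{..5} \<union> {8}. R2 r = R1 r"
    "reaches (12 * n + 10) (Config 13 R1 M) (Config (if found then 25 else 30) R2 M)"
    using string_loop[of R1 m i "J + 1" n "m + 1" M] Suc.prems
    unfolding found_def by (auto simp: R1_def)
  have R2_eq: "R2 r = R r" if "r \<le> 5 \<or> r = 8" for r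
    using R2(1) that by (auto simp: R1_def)
  have reach: "reaches (12 * n + 15) (Config 8 R M) (Config (if found then 25 else 30) R2 M)"
    by (rule reaches_funpow[OF enter R2(2)]) simp
  show ?case
  proof (cases found)
    case False
    then have reject: "\<not> (\<forall>j<Suc J. \<exists>k<n. test M i (j + 1) (m + 1 + k * m))"
      unfolding found_def by blast
    have "reaches ((12 * n + 17) * Suc J + 1) (Config 8 R M) (Config 30 R2 M)"
      by (intro reaches_mono[OF reach[unfolded if_not_P[OF False]]]) simp
    then show ?thesis unfolding if_not_P[OF reject] using R2_eq by (intro exI[of _ R2]) simp
  next
    case True
    define R3 where "R3 = R2(5 := J)"
    have R3: "R3 1 = 1" "R3 2 = m" "R3 3 = n" "R3 0 = 0" "R3 4 = i" "R3 5 = J" "R3 8 = M (i + 1)"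
      using Suc.prems by (simp_all add: R3_def R2_eq)
    have next_column: "(step decide ^^ 2) (Config 25 R2 M) = Config 8 R3 M"
      using Suc.prems by (simp add: funpow_numeral R2_eq R3_def)
    obtain R' where R': "\<forall>r\<le>4. R' r = R3 r"
      "reaches ((12 * n + 17) * J + 1) (Config 8 R3 M)
        (Config (if \<forall>j<J. \<exists>k<n. test M i (j + 1) (m + 1 + k * m) then 27 else 30) R' M)"
      using Suc.IH[of R3, OF R3] by blast
    have "(\<forall>j<Suc J. \<exists>k<n. test M i (j + 1) (m + 1 + k * m)) \<longleftrightarrow>
        (\<forall>j<J. \<exists>k<n. test M i (j + 1) (m + 1 + k * m))"
      using True unfolding found_def by (auto simp: less_Suc_eq)
    moreover have "reaches (12 * n + 15 + (2 + ((12 * n + 17) * J + 1))) (Config 8 R M)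
        (Config (if \<forall>j<J. \<exists>k<n. test M i (j + 1) (m + 1 + k * m) then 27 else 30) R' M)"
      using True reach
      by (intro reaches_trans[OF _ reaches_funpow[OF next_column R'(2) order_refl]]) simp
    moreover have "12 * n + 15 + (2 + ((12 * n + 17) * J + 1)) = (12 * n + 17) * Suc J + 1"
      by simp
    ultimately show ?thesis
      using R'(1) by (intro exI[of _ R']) (simp add: R3_def R2_eq)
  qed
qed

text \<open>One row costs 4 steps to enter, the column loop, and 2 steps to move on. Register 0
  stays 0 throughout: it is the zero used to copy registers by addition, and it is already the
  negative answer when a failing column jumps to 30, the end of the program.\<close>

lemma row_loop:
  assumes "R 1 = 1" "R 2 = m" "R 3 = n" "R 0 = 0" "R 4 = I"
  shows "\<exists>R'. R' 0 = 0 \<and>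
    reaches (((12 * n + 17) * m + 7) * I + 1) (Config 4 R M)
      (Config (if \<forall>i<I. \<forall>j<m. \<exists>k<n. test M (i + 1) (j + 1) (m + 1 + k * m) then 29 else 30) R' M)"
  using assms
proof (induction I arbitrary: R)
  case 0
  have "reaches (((12 * n + 17) * m + 7) * 0 + 1) (Config 4 R M) (Config 29 R M)"
    by (rule reaches_funpow[where k = 1, OF _ reaches_refl[of 0]]) (simp_all add: 0)
  then show ?case using 0 by (intro exI[of _ R]) simp
next
  case (Suc I)
  define passed where "passed \<longleftrightarrow> (\<forall>j<m. \<exists>k<n. test M (I + 1) (j + 1) (m + 1 + k * m))"
  define R1 where "R1 = R(8 := M (I + 2), 5 := m)"
  have enter: "(step decide ^^ 4) (Config 4 R M) = Config 8 R1 M"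
    using Suc.prems by (simp add: funpow_numeral R1_def)
  obtain R2 where R2: "\<forall>r\<le>4. R2 r = R1 r"
    "reaches ((12 * n + 17) * m + 1) (Config 8 R1 M) (Config (if passed then 27 else 30) R2 M)"
    using column_loop[of R1 m n "I + 1" m M] Suc.prems
    unfolding passed_def by (auto simp: R1_def)
  have R2_eq: "R2 r = R r" if "r \<le> 4" for r
    using R2(1) that by (auto simp: R1_def)
  have reach: "reaches ((12 * n + 17) * m + 5) (Config 4 R M) (Config (if passed then 27 else 30) R2 M)"
    by (rule reaches_funpow[OF enter R2(2)]) simp
  show ?case
  proof (cases passed)
    case False
    then have reject: "\<not> (\<forall>i<Suc I. \<forall>j<m. \<exists>k<n. test M (i + 1) (j + 1) (m + 1 + k * m))"
      unfolding passed_def by blast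
    have "reaches (((12 * n + 17) * m + 7) * Suc I + 1) (Config 4 R M) (Config 30 R2 M)"
      by (intro reaches_mono[OF reach[unfolded if_not_P[OF False]]]) simp
    then show ?thesis
      unfolding if_not_P[OF reject] using R2_eq Suc.prems by (intro exI[of _ R2]) simp
  next
    case True
    define R3 where "R3 = R2(4 := I)"
    have R3: "R3 1 = 1" "R3 2 = m" "R3 3 = n" "R3 0 = 0" "R3 4 = I"
      using Suc.prems by (simp_all add: R3_def R2_eq)
    have next_row: "(step decide ^^ 2) (Config 27 R2 M) = Config 4 R3 M"
      using Suc.prems by (simp add: funpow_numeral R2_eq R3_def)
    obtain R' where R': "R' 0 = 0"
      "reaches (((12 * n + 17) * m + 7) * I + 1) (Config 4 R3 M)
        (Config (if \<forall>i<I. \<forall>j<m. \<exists>k<n. test M (i + 1) (j + 1) (m + 1 + k * m) then 29 else 30) R' M)"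
      using Suc.IH[of R3, OF R3] by blast
    have "(\<forall>i<Suc I. \<forall>j<m. \<exists>k<n. test M (i + 1) (j + 1) (m + 1 + k * m)) \<longleftrightarrow>
        (\<forall>i<I. \<forall>j<m. \<exists>k<n. test M (i + 1) (j + 1) (m + 1 + k * m))"
      using True unfolding passed_def by (auto simp: less_Suc_eq)
    moreover have "reaches ((12 * n + 17) * m + 5 + (2 + (((12 * n + 17) * m + 7) * I + 1))) (Config 4 R M)
        (Config (if \<forall>i<I. \<forall>j<m. \<exists>k<n. test M (i + 1) (j + 1) (m + 1 + k * m) then 29 else 30) R' M)"
      using True reach
      by (intro reaches_trans[OF _ reaches_funpow[OF next_row R'(2) order_refl]]) simp
    moreover have "(12 * n + 17) * m + 5 + (2 + (((12 * n + 17) * m + 7) * I + 1)) =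
        ((12 * n + 17) * m + 7) * Suc I + 1"
      by simp
    ultimately show ?thesis
      using R'(1) by (intro exI[of _ R']) simp
  qed
qed

lemma decide_run:
  assumes "M 0 = m" "M 1 = n" "m \<ge> 1" "n \<ge> 1"
  shows "\<exists>R'. R' 0 = of_bool (\<forall>i<m. \<forall>j<m. \<exists>k<n. test M (i + 1) (j + 1) (m + 1 + k * m)) \<and>
    reaches (50 * (m\<^sup>2 * n)) (Config 0 (\<lambda>_. 0) M) (Config 30 R' M)"
proof -
  define ok where "ok \<longleftrightarrow> (\<forall>i<m. \<forall>j<m. \<exists>k<n. test M (i + 1) (j + 1) (m + 1 + k * m))"
  define R1 :: "nat \<Rightarrow> nat" where "R1 = (\<lambda>_. 0)(1 := 1, 2 := m, 3 := n, 4 := m)"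
  have enter: "(step decide ^^ 4) (Config 0 (\<lambda>_. 0) M) = Config 4 R1 M"
    using assms by (simp add: funpow_numeral R1_def)
  let ?T = "((12 * n + 17) * m + 7) * m + 1"
  obtain R2 where R2: "R2 0 = 0" "reaches ?T (Config 4 R1 M) (Config (if ok then 29 else 30) R2 M)"
    using row_loop[of R1 m n m M] unfolding ok_def by (auto simp: R1_def)
  define R' where "R' = R2(0 := of_bool ok)"
  have "R2 = R'" if "\<not> ok"
    using that R2(1) by (simp add: R'_def fun_upd_idem)
  \<comment> \<open>Acceptance executes one more instruction, which sets register 0; rejection has
    already halted. Hence the step count \<open>of_bool ok\<close>.\<close>
  then have "(step decide ^^ of_bool ok) (Config (if ok then 29 else 30) R2 M) = Config 30 R' M"
    by (cases ok) (simp_all add: R'_def)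
  then have "reaches 1 (Config (if ok then 29 else 30) R2 M) (Config 30 R' M)"
    by (rule reaches_funpow[OF _ reaches_refl[of 0]]) simp
  then have "reaches (?T + 1) (Config 4 R1 M) (Config 30 R' M)"
    by (rule reaches_trans[OF R2(2)])
  \<comment> \<open>As \<open>m\<close> and \<open>n\<close> are positive, each of
    \<open>m * m\<close>, \<open>m\<close> and 1 is at most \<open>m * m * n\<close>, so the total
    is at most 12 + 17 + 7 + 6 = 42 times that.\<close>
  moreover have "4 + (?T + 1) \<le> 50 * (m\<^sup>2 * n)"
  proof -
    have "m * 1 \<le> m * (m * n)" "m * m * 1 \<le> m * m * n" "1 \<le> m * m * n"
      using assms by (auto simp: Suc_le_eq simp del: mult_1_right intro!: mult_le_mono)
    then have "m \<le> m * m * n" "m * m \<le> m * m * n" "1 \<le> m * m * n"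
      by (simp_all add: mult.assoc)
    moreover have "?T = 12 * (m * m * n) + 17 * (m * m) + 7 * m + 1"
      by (simp add: algebra_simps)
    ultimately show ?thesis unfolding power2_eq_square by linarith
  qed
  ultimately have "reaches (50 * (m\<^sup>2 * n)) (Config 0 (\<lambda>_. 0) M) (Config 30 R' M)"
    by (rule reaches_funpow[OF enter])
  then show ?thesis
    by (intro exI[of _ R']) (simp add: R'_def ok_def)
qed


section \<open>Correctness on encoded inputs\<close>

lemma nth_concat_equal_length:
  assumes "\<forall>x\<in>set xs. length x = m" "k < length xs" "i < m"
  shows "concat xs ! (k * m + i) = xs ! k ! i"
  using assms by (induction xs arbitrary: k) (auto simp: nth_append nth_Cons split: nat.split)

text \<open>Stated for an arbitrary nonempty list of strings, so that it covers enumerations of both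
  \<open>W\<close> and \<open>W\<close> with its negations.\<close>

lemma decide_answers:
  assumes ws: "set ws \<subseteq> bitstrings m" "ws \<noteq> []" and s: "length s = m" "m \<ge> 1"
  shows "\<exists>t \<le> 50 * (m\<^sup>2 * length ws).
    answers_after decide (encode_input ws s) t (representable (set ws) s)"
proof -
  define n where "n = length ws"
  define inp where "inp = encode_input ws s"
  define M where "M a = (if a < length inp then inp ! a else 0)" for a
  have len: "length w = m" if "w \<in> set ws" for w
    using ws(1) that by (auto simp: bitstrings_def)
  have "length (concat (map (map of_bool :: bitstring \<Rightarrow> nat list) ws)) = n * m"
    using len unfolding n_def by (induction ws) auto
  then have length_inp: "length inp = 2 + m + n * m"
    by (simp add: inp_def encode_input_def s(1))
  have M01: "M 0 = m" "M 1 = n"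
    using s by (simp_all add: M_def length_inp) (simp_all add: inp_def encode_input_def n_def)
  \<comment> \<open>Two header cells precede \<open>s\<close>, so bit \<open>i\<close> is in cell
    \<open>i + 2\<close>, which is the 1-based counter \<open>i + 1\<close> plus 1.\<close>
  have M_s: "M (i + 1 + 1) = of_bool (s ! i)" if "i < m" for i
    using that s(1) by (simp add: M_def length_inp) (simp add: inp_def encode_input_def nth_append)
  \<comment> \<open>String \<open>k\<close> starts in cell \<open>2 + m + k * m\<close>; the base is
    one less because the counter \<open>i + 1\<close> is 1-based.\<close>
  have M_w: "M (m + 1 + k * m + (i + 1)) = of_bool (ws ! k ! i)" if "k < n" "i < m" for k i
  proof -
    have "k * m + i < Suc k * m" using that by simp
    also have "\<dots> \<le> n * m" using that by (intro mult_le_mono1) simp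
    finally have "m + 1 + k * m + (i + 1) < length inp" by (simp add: length_inp)
    moreover have "concat (map (map of_bool) ws) ! (k * m + i) = (of_bool (ws ! k ! i) :: nat)"
      using that len by (subst nth_concat_equal_length[where m = m]) (auto simp: n_def)
    moreover have "inp ! (m + 1 + k * m + (i + 1)) = concat (map (map of_bool) ws) ! (k * m + i)"
      using s(1) by (simp add: inp_def encode_input_def nth_append)
    ultimately show ?thesis by (simp add: M_def)
  qed
  have "test M (i + 1) (j + 1) (m + 1 + k * m) \<longleftrightarrow>
      (s ! i \<longrightarrow> ws ! k ! i) \<and> (ws ! k ! j \<longrightarrow> s ! j)" if "i < m" "j < m" "k < n" for i j k
    unfolding test_def M_s[OF that(1)] M_s[OF that(2)] M_w[OF that(3,1)] M_w[OF that(3,2)] by simp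
  then have "(\<forall>i<m. \<forall>j<m. \<exists>k<n. test M (i + 1) (j + 1) (m + 1 + k * m)) \<longleftrightarrow> separated (set ws) s"
    unfolding separated_def s(1) n_def by (auto simp: Bex_def in_set_conv_nth) metis+
  also have "\<dots> \<longleftrightarrow> representable (set ws) s"
    using representable_iff_separated[OF ws(1) s] by simp
  finally obtain R' t where "R' 0 = of_bool (representable (set ws) s)" "t \<le> 50 * (m\<^sup>2 * n)"
    "(step decide ^^ t) (Config 0 (\<lambda>_. 0) M) = Config 30 R' M"
    using decide_run[OF M01] s(2) ws(2) unfolding reaches_def n_def
    by (auto simp: Suc_le_eq)
  moreover have "initial_config inp = Config 0 (\<lambda>_. 0) M"
    by (simp add: initial_config_def M_def[abs_def])
  ultimately show ?thesis
    unfolding answers_after_def inp_def[symmetric] n_def[symmetric]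
    by (intro exI[of _ t]) (simp add: halted_def length_decide)
qed

theorem mainTheorem1:
  "\<exists>(\<A> :: program) (C :: nat).
     \<forall>(m :: nat) (n :: nat) (W :: bitstring set) (s :: bitstring).
       m \<ge> 1 \<and> n \<ge> 1 \<and> W \<subseteq> bitstrings m \<and> card W = n \<and> s \<in> bitstrings m \<longrightarrow>
         (\<forall>ws. distinct ws \<and> set ws = W \<longrightarrow>
            (\<exists>t \<le> C * (m ^ 2 * n).
               answers_after \<A> (encode_input ws s) t (representable W s))) \<and>
         (\<forall>us. distinct us \<and> set us = W \<union> bit_neg ` W \<longrightarrow>
            (\<exists>t. answers_after \<A> (encode_input us s) t (representable_with_negation W s)))"
proof (rule exI[of _ decide], rule exI[of _ 50], intro allI impI conjI; elim conjE)
  fix m n W s ws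
  assume "1 \<le> m" "1 \<le> n" "W \<subseteq> bitstrings m" "card W = n" "s \<in> bitstrings m"
    "distinct ws" "set ws = W"
  moreover from this have "length ws = n" "ws \<noteq> []"
    by (auto simp: distinct_card)
  ultimately show
    "\<exists>t \<le> 50 * (m\<^sup>2 * n). answers_after decide (encode_input ws s) t (representable W s)"
    using decide_answers[of ws m s] by (simp add: bitstrings_def)
next
  fix m n W s us
  assume *: "1 \<le> m" "1 \<le> n" "W \<subseteq> bitstrings m" "card W = n" "s \<in> bitstrings m"
    "distinct us" "set us = W \<union> bit_neg ` W"
  \<comment> \<open>Negation preserves length, and \<open>W\<close> is nonempty because its
    cardinality is positive.\<close>
  then have "set us \<subseteq> bitstrings m" "us \<noteq> []"
    by (auto simp: bitstrings_def bit_neg_def)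
  then have "\<exists>t. answers_after decide (encode_input us s) t (representable (set us) s)"
    using decide_answers[of us m s] * by (auto simp: bitstrings_def)
  then show "\<exists>t. answers_after decide (encode_input us s) t (representable_with_negation W s)"
    by (simp only: representable_with_negation_iff *)
qed

end
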